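(* Let $0<p<\infty$ and let $W$ be a matrix weight on $\mathbb{R}^n$ (not necessarily invertible). Let $U$ be a measurable $d\times d$ matrix function on $\mathbb{R}^n$ such that $U(x)$ is unitary and $U^H(x)W(x)U(x)$ is diagonal for every $x$, and set $D^{1/p}:=U^HW^{1/p}U$. A subset $\mathcal{F}\subset L^p(W)$ is totally bounded if: (a) $\sup_{\mathbf{f}\in\mathcal{F}}\|\mathbf{f}\|_{L^p(W)}<\infty$; (b) $\lim_{R\to\infty}\sup_{\mathbf{f}\in\mathcal{F}}\|\mathbf{f}\chi_{B^c(0,R)}\|_{L^p(W)}=0$; (c* ) $\displaystyle\lim_{r\to0}\sup_{\mathbf{f}\in\mathcal{F}}\sup_{y\in B(0,r)}\Big(\int_{\mathbb{R}^n}\big|D^{1/p}(x)\big(U^H(x-y)\mathbf{f}(x-y)-U^H(x)\mathbf{f}(x)\big)\big|^pdx\Big)^{1/p}=0.$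
   Context: A matrix weight is a measurable map $W:\mathbb{R}^n\to\mathcal{S}_d$ (self-adjoint non-negative-definite complex $d\times d$ matrices) with $\|W\|_{op}\in L^1_{\rm loc}(\mathbb{R}^n)$. For $A\in\mathcal{S}_d$ with $A=VD(\lambda_1,\dots,\lambda_d)V^H$ ($V$ unitary), $A^s:=VD(\lambda_i^s)V^H$ for $s>0$. Such a measurable unitary diagonalizing $U$ always exists. $L^p(W)$ is the space of measurable $\mathbf{f}:\mathbb{R}^n\to\mathbb{C}^d$ with $\|\mathbf{f}\|_{L^p(W)}^p:=\int_{\mathbb{R}^n}|W^{1/p}(x)\mathbf{f}(x)|^pdx<\infty$ (a quasi-norm when $p<1$); total boundedness is with respect to the induced (quasi-)metric. *)

theory Defs
  imports "HOL-Analysis.Analysis"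
begin

type_synonym 'd cvec = "complex ^ 'd"
type_synonym 'd cmat = "complex ^ 'd ^ 'd"

definition adj :: "'d::finite cmat \<Rightarrow> 'd cmat" where
  "adj A = (\<chi> i j. cnj (A $ j $ i))"

definition unitary :: "'d::finite cmat \<Rightarrow> bool" where
  "unitary U \<longleftrightarrow> U ** adj U = mat 1 \<and> adj U ** U = mat 1"

definition diag_mat :: "('d::finite \<Rightarrow> complex) \<Rightarrow> 'd cmat" where
  "diag_mat l = (\<chi> i j. if i = j then l i else 0)"

definition is_diagonal :: "'d::finite cmat \<Rightarrow> bool" where
  "is_diagonal A \<longleftrightarrow> (\<forall>i j. i \<noteq> j \<longrightarrow> A $ i $ j = 0)"

definition psd :: "'d::finite cmat \<Rightarrow> bool" where
  "psd A \<longleftrightarrow> adj A = A \<and>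
     (\<forall>v :: 'd cvec. let q = (\<Sum>i\<in>UNIV. cnj (v $ i) * (A *v v) $ i) in Im q = 0 \<and> Re q \<ge> 0)"

definition mpow :: "'d::finite cmat \<Rightarrow> real \<Rightarrow> 'd cmat" where
  "mpow A s = (THE B. \<exists>V (l :: 'd \<Rightarrow> real). unitary V \<and> (\<forall>i. l i \<ge> 0) \<and>
       A = V ** diag_mat (\<lambda>i. complex_of_real (l i)) ** adj V \<and>
       B = V ** diag_mat (\<lambda>i. complex_of_real (l i powr s)) ** adj V)"

definition matrix_weight :: "(real^'n::finite \<Rightarrow> 'd::finite cmat) \<Rightarrow> bool" where
  "matrix_weight W \<longleftrightarrow> W \<in> borel_measurable lebesgue \<and> (\<forall>x. psd (W x)) \<and>
     (\<forall>K. compact K \<longrightarrow> set_integrable lebesgue K (\<lambda>x. onorm (\<lambda>v. W x *v v)))"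

definition epow :: "ennreal \<Rightarrow> real \<Rightarrow> ennreal" where
  "epow a s = (if a = \<infinity> then \<infinity> else ennreal (enn2real a powr s))"

definition Lpw_norm :: "real \<Rightarrow> (real^'n::finite \<Rightarrow> 'd::finite cmat) \<Rightarrow> (real^'n \<Rightarrow> 'd cvec) \<Rightarrow> ennreal" where
  "Lpw_norm p W f = epow (\<integral>\<^sup>+ x. ennreal (norm (mpow (W x) (1/p) *v f x) powr p) \<partial>lebesgue) (1/p)"

definition LpW :: "real \<Rightarrow> (real^'n::finite \<Rightarrow> 'd::finite cmat) \<Rightarrow> (real^'n \<Rightarrow> 'd cvec) set" where
  "LpW p W = {f. f \<in> borel_measurable lebesgue \<and> Lpw_norm p W f < \<infinity>}"

definition LpW_totally_bounded :: "real \<Rightarrow> (real^'n::finite \<Rightarrow> 'd::finite cmat) \<Rightarrow> (real^'n \<Rightarrow> 'd cvec) set \<Rightarrow> bool" where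
  "LpW_totally_bounded p W F \<longleftrightarrow> (\<forall>e>0. \<exists>K. finite K \<and> K \<subseteq> F \<and>
      F \<subseteq> (\<Union>g\<in>K. {f. Lpw_norm p W (\<lambda>x. f x - g x) < ennreal e}))"

end

theory Submission
  imports Defs
begin

text \<open>
  Put \<open>g = U\<^sup>H f\<close>. Since \<open>W^(1/p) = U D^(1/p) U\<^sup>H\<close> with \<open>U\<close> unitary, the problem decouples into the real
  and imaginary parts of the components of \<open>g\<close>, each with a locally integrable scalar weight.
  For a scalar function and a locally finite measure \<open>\<nu>\<close>, cut space into cubes of side \<open>d\<close> and let
  \<open>cell d x\<close> be the corner of the cube of \<open>x\<close>. By Tonelli, the average over \<open>t \<in> (0, d)\<^sup>n\<close> of
  \<open>\<integral>|g(cell d x + t) - g x|\<^sup>p d\<nu>\<close> is at most \<open>2\<^sup>n\<close> times the supremum of the translation moduli in (c*),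
  so for some \<open>t\<close> the function \<open>g\<close> is close to one that is constant on cubes. By (a) and (b), only
  finitely many bounded values matter; rounding them sorts the family into finitely many classes of
  small diameter. Cubes of measure zero, on which the values are not controlled, do not contribute.
\<close>

lemma nn_integral_lborel_reflect:
  fixes g :: "'a::euclidean_space \<Rightarrow> ennreal"
  assumes [measurable]: "g \<in> borel_measurable borel"
  shows "(\<integral>\<^sup>+ t. g (a - t) \<partial>lborel) = (\<integral>\<^sup>+ t. g t \<partial>lborel)"
proof -
  have "(\<integral>\<^sup>+ t. g t \<partial>lborel)
    = (\<integral>\<^sup>+ t. g t \<partial>density (distr lborel borel (\<lambda>x. a + (-1) *\<^sub>R x)) (\<lambda>_. ennreal (\<bar>-1\<bar> ^ DIM('a))))"
    by (subst lborel_affine[of "-1" a]) auto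
  also have "\<dots> = (\<integral>\<^sup>+ t. g (a - t) \<partial>lborel)"
    by (subst nn_integral_density) (auto simp: nn_integral_distr)
  finally show ?thesis by simp
qed

definition cell :: "real \<Rightarrow> 'a::euclidean_space \<Rightarrow> 'a" where
  "cell d x = (\<Sum>i\<in>Basis. (d * of_int \<lfloor>(x \<bullet> i) / d\<rfloor>) *\<^sub>R i)"

lemma cell_inner: "i \<in> Basis \<Longrightarrow> cell d x \<bullet> i = d * of_int \<lfloor>(x \<bullet> i) / d\<rfloor>"
  by (simp add: cell_def inner_sum_left inner_Basis if_distrib cong: if_cong)

lemma cell_bounds:
  assumes "0 < d" "i \<in> Basis"
  shows "0 \<le> (x - cell d x) \<bullet> i" "(x - cell d x) \<bullet> i < d"
proof -
  have "d * of_int \<lfloor>(x \<bullet> i) / d\<rfloor> \<le> x \<bullet> i"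
    using of_int_floor_le[of "(x \<bullet> i) / d"] assms(1)
    unfolding pos_le_divide_eq[OF assms(1)] by (simp add: mult.commute)
  moreover have "x \<bullet> i < d * of_int \<lfloor>(x \<bullet> i) / d\<rfloor> + d"
    using floor_less_cancel[of "(x \<bullet> i) / d" "of_int \<lfloor>(x \<bullet> i) / d\<rfloor> + 1"] assms(1)
    by (simp add: pos_divide_less_eq algebra_simps)
  ultimately show "0 \<le> (x - cell d x) \<bullet> i" "(x - cell d x) \<bullet> i < d"
    using assms by (simp_all add: inner_diff_left cell_inner)
qed

lemma cell_measurable [measurable]: "cell d \<in> borel_measurable borel"
  unfolding cell_def by measurable

lemma finite_cell_image:
  fixes S :: "'a::euclidean_space set"
  assumes "0 < d" "bounded S"
  shows "finite (cell d ` S)"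
proof -
  obtain B where B: "\<And>x. x \<in> S \<Longrightarrow> norm x \<le> B"
    using assms(2) by (auto simp: bounded_iff)
  define N where "N = \<lfloor>B / d\<rfloor> + 1"
  define h :: "('a \<Rightarrow> int) \<Rightarrow> 'a" where "h = (\<lambda>k. \<Sum>i\<in>Basis. (d * of_int (k i)) *\<^sub>R i)"
  have "cell d ` S \<subseteq> h ` (PiE Basis (\<lambda>_. {-N..N}))"
  proof
    fix y assume "y \<in> cell d ` S"
    then obtain x where x: "x \<in> S" and y: "y = cell d x" by auto
    let ?k = "restrict (\<lambda>i. \<lfloor>(x \<bullet> i) / d\<rfloor>) Basis"
    have "y = h ?k" unfolding h_def y cell_def by (intro sum.cong) auto
    moreover have "\<lfloor>(x \<bullet> i) / d\<rfloor> \<in> {-N..N}" if "i \<in> Basis" for i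
    proof -
      have "\<bar>x \<bullet> i\<bar> \<le> B" using Basis_le_norm[OF that, of x] B[OF x] by linarith
      then have "(x \<bullet> i) / d \<le> B / d" "-(B / d) \<le> (x \<bullet> i) / d"
        using assms(1) by (auto simp: field_simps)
      then have "\<lfloor>(x \<bullet> i) / d\<rfloor> \<le> N" "-N \<le> \<lfloor>(x \<bullet> i) / d\<rfloor>" unfolding N_def by linarith+
      then show ?thesis by simp
    qed
    ultimately show "y \<in> h ` (PiE Basis (\<lambda>_. {-N..N}))" by (intro image_eqI[of _ _ ?k]) auto
  qed
  then show ?thesis by (rule finite_subset) (intro finite_imageI finite_PiE; simp)
qed

lemma bounded_cell_vimage:
  fixes k :: "'a::euclidean_space" and d :: real
  assumes "0 < d"
  shows "cell d -` {k} \<subseteq> cball 0 (norm k + DIM('a) * d)"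
proof
  fix x assume "x \<in> cell d -` {k}"
  then have k: "k = cell d x" by auto
  have "norm (x - cell d x) \<le> (\<Sum>i\<in>Basis. \<bar>(x - cell d x) \<bullet> i\<bar>)" by (rule norm_le_l1)
  also have "\<dots> \<le> (\<Sum>i\<in>(Basis::'a set). d)"
    using cell_bounds[OF assms, of _ x] by (intro sum_mono) (simp add: abs_of_nonneg less_imp_le)
  finally have "norm x \<le> norm k + DIM('a) * d"
    unfolding k using norm_triangle_sub[of x "cell d x"] by auto
  then show "x \<in> cball 0 (norm k + DIM('a) * d)" by simp
qed

text \<open>Averaging over the sampling offset \<open>t\<close> replaces the usual convolution, which would need
  local integrability and fails for \<open>p < 1\<close>.\<close>

lemma exists_sampling_offset:
  fixes \<phi> :: "'a::euclidean_space \<Rightarrow> 'a \<Rightarrow> ennreal"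
  assumes "sigma_finite_measure \<nu>" and sets_nu [measurable_cong]: "sets \<nu> = sets borel"
    and phi [measurable]: "case_prod \<phi> \<in> borel_measurable (borel \<Otimes>\<^sub>M borel)"
    and d: "0 < d" and \<eta>: "0 < \<eta>"
    and trans: "\<And>y. y \<in> box (- d *\<^sub>R One) (d *\<^sub>R One) \<Longrightarrow> (\<integral>\<^sup>+ x. \<phi> (x - y) x \<partial>\<nu>) \<le> ennreal \<eta>"
  shows "\<exists>t. (\<integral>\<^sup>+ x. \<phi> (cell d x + t) x \<partial>\<nu>) \<le> ennreal ((2 ^ DIM('a) + 1) * \<eta>)"
proof (rule ccontr)
  assume "\<not> ?thesis"
  then have big: "ennreal ((2 ^ DIM('a) + 1) * \<eta>) \<le> (\<integral>\<^sup>+ x. \<phi> (cell d x + t) x \<partial>\<nu>)" for t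
    by (meson linear)
  interpret sigma_finite_measure \<nu> by fact
  interpret pair_sigma_finite \<nu> "lborel :: 'a measure" by unfold_locales
  let ?B = "box 0 (d *\<^sub>R One) :: 'a set"
  let ?C = "box (- d *\<^sub>R One) (d *\<^sub>R One) :: 'a set"
  have mB: "emeasure lborel ?B = ennreal (d ^ DIM('a))"
    using d by (subst emeasure_lborel_box) auto
  have mC: "emeasure lborel ?C = ennreal ((2 * d) ^ DIM('a))"
    using d by (subst emeasure_lborel_box) (auto simp: inner_diff_left inner_add_left)
  have "ennreal ((2 ^ DIM('a) + 1) * \<eta>) * ennreal (d ^ DIM('a))
      = (\<integral>\<^sup>+ t. ennreal ((2 ^ DIM('a) + 1) * \<eta>) * indicator ?B t \<partial>lborel)"
    by (subst nn_integral_cmult_indicator) (auto simp: mB)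
  also have "\<dots> \<le> (\<integral>\<^sup>+ t. (\<integral>\<^sup>+ x. \<phi> (cell d x + t) x * indicator ?B t \<partial>\<nu>) \<partial>lborel)"
    using big by (intro nn_integral_mono) (auto simp: indicator_def)
  also have "\<dots> = (\<integral>\<^sup>+ x. (\<integral>\<^sup>+ t. \<phi> (cell d x + t) x * indicator ?B t \<partial>lborel) \<partial>\<nu>)"
    by (rule Fubini') measurable
  also have "\<dots> \<le> (\<integral>\<^sup>+ x. (\<integral>\<^sup>+ y. \<phi> (x - y) x * indicator ?C y \<partial>lborel) \<partial>\<nu>)"
  proof (rule nn_integral_mono)
    fix x
    have "(\<integral>\<^sup>+ t. \<phi> (cell d x + t) x * indicator ?B t \<partial>lborel)
        = (\<integral>\<^sup>+ y. \<phi> (cell d x + (x - cell d x - y)) x * indicator ?B (x - cell d x - y) \<partial>lborel)"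
      by (rule nn_integral_lborel_reflect[symmetric]) measurable
    also have "\<dots> \<le> (\<integral>\<^sup>+ y. \<phi> (x - y) x * indicator ?C y \<partial>lborel)"
    proof (rule nn_integral_mono)
      fix y
      have "y \<in> ?C" if "x - cell d x - y \<in> ?B"
      proof -
        have "- d < y \<bullet> i \<and> y \<bullet> i < d" if "i \<in> Basis" for i
          using \<open>x - cell d x - y \<in> ?B\<close> that cell_bounds[OF d that, of x]
          by (fastforce simp: mem_box inner_diff_left)
        then show ?thesis by (auto simp: mem_box)
      qed
      then show "\<phi> (cell d x + (x - cell d x - y)) x * indicator ?B (x - cell d x - y)
          \<le> \<phi> (x - y) x * indicator ?C y"
        by (auto simp: indicator_def)
    qed
    finally show "(\<integral>\<^sup>+ t. \<phi> (cell d x + t) x * indicator ?B t \<partial>lborel)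
        \<le> (\<integral>\<^sup>+ y. \<phi> (x - y) x * indicator ?C y \<partial>lborel)" .
  qed
  also have "\<dots> = (\<integral>\<^sup>+ y. (\<integral>\<^sup>+ x. \<phi> (x - y) x * indicator ?C y \<partial>\<nu>) \<partial>lborel)"
    by (rule Fubini'[symmetric]) measurable
  also have "\<dots> \<le> (\<integral>\<^sup>+ y. ennreal \<eta> * indicator ?C y \<partial>lborel)"
    using trans by (intro nn_integral_mono) (auto simp: indicator_def)
  also have "\<dots> = ennreal \<eta> * ennreal ((2 * d) ^ DIM('a))"
    by (subst nn_integral_cmult_indicator, simp, simp only: mC)
  finally have "(2 ^ DIM('a) + 1) * \<eta> * d ^ DIM('a) \<le> \<eta> * (2 * d) ^ DIM('a)"
    using d \<eta> by (simp add: ennreal_mult[symmetric] del: ennreal_power)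
  then show False using mult_pos_pos[OF \<eta> zero_less_power[OF d, of "DIM('a)"]]
    by (simp add: power_mult_distrib algebra_simps)
qed

lemma powr_sum_le:
  fixes a :: "'i \<Rightarrow> real"
  assumes "finite I" "0 < p" "\<And>i. i \<in> I \<Longrightarrow> 0 \<le> a i"
  shows "(\<Sum>i\<in>I. a i) powr p \<le> real (card I) powr p * (\<Sum>i\<in>I. a i powr p)"
proof (cases "I = {}")
  case False
  let ?m = "Max (a ` I)"
  have fin: "finite (a ` I)" "a ` I \<noteq> {}" using assms(1) False by auto
  obtain j where j: "j \<in> I" "?m = a j" using Max_in[OF fin] by auto
  have "(\<Sum>i\<in>I. a i) \<le> (\<Sum>i\<in>I. ?m)" using fin by (intro sum_mono) auto
  then have "(\<Sum>i\<in>I. a i) powr p \<le> (real (card I) * ?m) powr p"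
    using assms by (intro powr_mono2) (auto intro: sum_nonneg)
  also have "\<dots> = real (card I) powr p * a j powr p"
    using j assms by (simp add: powr_mult)
  also have "a j powr p \<le> (\<Sum>i\<in>I. a i powr p)"
    by (rule member_le_sum) (use j assms in auto)
  finally show ?thesis by (simp add: mult_left_mono)
qed (use assms in auto)

lemma norm_add_powr_le:
  fixes x y :: "'b::real_normed_vector"
  assumes "0 < p"
  shows "norm (x + y) powr p \<le> 2 powr p * (norm x powr p + norm y powr p)"
proof -
  have "norm (x + y) powr p \<le> (\<Sum>b\<in>{True, False}. norm (if b then x else y)) powr p"
    using assms norm_triangle_ineq[of x y] by (intro powr_mono2) auto
  also have "\<dots> \<le> 2 powr p * (norm x powr p + norm y powr p)"
    using powr_sum_le[of "{True, False}" p "\<lambda>b. norm (if b then x else y)"] assms by simp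
  finally show ?thesis .
qed

lemma nn_integral_add_powr_le:
  fixes f g :: "'a \<Rightarrow> 'b::{real_normed_vector, second_countable_topology}"
  assumes p: "0 < p" and [measurable]: "f \<in> borel_measurable M" "g \<in> borel_measurable M"
  shows "(\<integral>\<^sup>+ x. ennreal (norm (f x + g x) powr p) \<partial>M)
    \<le> ennreal (2 powr p) * ((\<integral>\<^sup>+ x. ennreal (norm (f x) powr p) \<partial>M) + (\<integral>\<^sup>+ x. ennreal (norm (g x) powr p) \<partial>M))"
proof -
  have "(\<integral>\<^sup>+ x. ennreal (norm (f x + g x) powr p) \<partial>M)
    \<le> (\<integral>\<^sup>+ x. ennreal (2 powr p) * (ennreal (norm (f x) powr p) + ennreal (norm (g x) powr p)) \<partial>M)"
    using norm_add_powr_le[OF p]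
    by (intro nn_integral_mono) (simp add: ennreal_mult'[symmetric] ennreal_plus[symmetric] del: ennreal_plus)
  also have "\<dots> = ennreal (2 powr p) * ((\<integral>\<^sup>+ x. ennreal (norm (f x) powr p) \<partial>M) + (\<integral>\<^sup>+ x. ennreal (norm (g x) powr p) \<partial>M))"
    by (simp add: nn_integral_cmult nn_integral_add)
  finally show ?thesis .
qed

lemma sigma_finite_measure_cball:
  fixes \<nu> :: "'a::euclidean_space measure"
  assumes "sets \<nu> = sets borel" "\<And>R. emeasure \<nu> (cball 0 R) < \<infinity>"
  shows "sigma_finite_measure \<nu>"
proof
  show "\<exists>A. countable A \<and> A \<subseteq> sets \<nu> \<and> \<Union> A = space \<nu> \<and> (\<forall>a\<in>A. emeasure \<nu> a \<noteq> \<infinity>)"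
  proof (intro exI[of _ "range (\<lambda>n. cball 0 (real n))"] conjI)
    have "space \<nu> = UNIV" using sets_eq_imp_space_eq[OF assms(1)] by simp
    then show "(\<Union>n. cball (0::'a) (real n)) = space \<nu>"
      by (auto simp: real_arch_simple)
  qed (use assms in \<open>auto simp: less_top\<close>)
qed

lemma finite_code_of_precompact_borel:
  fixes \<nu> :: "'a::euclidean_space measure" and g :: "'f \<Rightarrow> 'a \<Rightarrow> real"
  assumes p: "0 < p" and sets_nu [measurable_cong]: "sets \<nu> = sets borel"
    and fin: "\<And>R. emeasure \<nu> (cball 0 R) < \<infinity>"
    and meas: "\<And>f. f \<in> F \<Longrightarrow> g f \<in> borel_measurable borel"
    and bdd: "\<And>f. f \<in> F \<Longrightarrow> (\<integral>\<^sup>+ x. ennreal (\<bar>g f x\<bar> powr p) \<partial>\<nu>) \<le> ennreal M"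
    and tail: "\<And>\<eta>. 0 < \<eta> \<Longrightarrow>
      \<exists>R. \<forall>f\<in>F. (\<integral>\<^sup>+ x. ennreal (\<bar>g f x\<bar> powr p) * indicator (- ball 0 R) x \<partial>\<nu>) \<le> ennreal \<eta>"
    and trans: "\<And>\<eta>. 0 < \<eta> \<Longrightarrow>
      \<exists>r>0. \<forall>f\<in>F. \<forall>y\<in>ball 0 r. (\<integral>\<^sup>+ x. ennreal (\<bar>g f (x - y) - g f x\<bar> powr p) \<partial>\<nu>) \<le> ennreal \<eta>"
    and \<epsilon>: "0 < \<epsilon>"
  shows "\<exists>code :: 'f \<Rightarrow> 'a \<Rightarrow> int. finite (code ` F) \<and>
    (\<forall>f\<in>F. \<forall>h\<in>F. code f = code h \<longrightarrow> (\<integral>\<^sup>+ x. ennreal (\<bar>g f x - g h x\<bar> powr p) \<partial>\<nu>) \<le> ennreal \<epsilon>)"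
proof -
  define c where "c = (2::real) powr p"
  have c: "1 \<le> c" "0 < c" using p by (auto simp: c_def ge_one_powr_ge_zero)
  define \<eta> where "\<eta> = \<epsilon> / (8 * c * c)"
  have \<eta>: "0 < \<eta>" using c \<epsilon> by (simp add: \<eta>_def)
  have quasi: "(\<integral>\<^sup>+ x. ennreal (\<bar>u x + v x\<bar> powr p) \<partial>N) \<le>
      ennreal c * ((\<integral>\<^sup>+ x. ennreal (\<bar>u x\<bar> powr p) \<partial>N) + (\<integral>\<^sup>+ x. ennreal (\<bar>v x\<bar> powr p) \<partial>N))"
    if "u \<in> borel_measurable N" "v \<in> borel_measurable N" for u v :: "'a \<Rightarrow> real" and N
    using nn_integral_add_powr_le[OF p that] by (simp add: c_def)
  obtain R where R: "\<And>f. f \<in> F \<Longrightarrow>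
      (\<integral>\<^sup>+ x. ennreal (\<bar>g f x\<bar> powr p) * indicator (- ball 0 R) x \<partial>\<nu>) \<le> ennreal \<eta>"
    using tail[OF \<eta>] by auto
  define \<eta>' where "\<eta>' = \<eta> / (2 ^ DIM('a) + 1)"
  have \<eta>': "0 < \<eta>'" "(2 ^ DIM('a) + 1) * \<eta>' = \<eta>"
    using \<eta> add_pos_pos[of "2 ^ DIM('a)" "1::real"] by (auto simp: \<eta>'_def)
  obtain r where r: "0 < r" "\<And>f y. f \<in> F \<Longrightarrow> y \<in> ball 0 r \<Longrightarrow>
      (\<integral>\<^sup>+ x. ennreal (\<bar>g f (x - y) - g f x\<bar> powr p) \<partial>\<nu>) \<le> ennreal \<eta>'"
    using trans[OF \<eta>'(1)] by auto
  define d where "d = r / (2 * DIM('a))"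
  have d: "0 < d" using r by (simp add: d_def)
  have box_ball: "y \<in> ball 0 r" if "y \<in> box (- d *\<^sub>R One) (d *\<^sub>R One)" for y :: 'a
  proof -
    have "norm y \<le> (\<Sum>i\<in>Basis. \<bar>y \<bullet> i\<bar>)" by (rule norm_le_l1)
    also have "\<dots> \<le> (\<Sum>i\<in>(Basis::'a set). d)"
      using that by (intro sum_mono) (force simp: mem_box abs_le_iff less_imp_le)
    also have "\<dots> < r" using r(1) by (simp add: d_def)
    finally show ?thesis by simp
  qed
  have "\<exists>t. \<forall>f\<in>F. (\<integral>\<^sup>+ x. ennreal (\<bar>g f (cell d x + t f) - g f x\<bar> powr p) \<partial>\<nu>) \<le> ennreal \<eta>"
  proof (rule bchoice, rule ballI)
    fix f assume f: "f \<in> F"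
    note [measurable] = meas[OF f]
    show "\<exists>t. (\<integral>\<^sup>+ x. ennreal (\<bar>g f (cell d x + t) - g f x\<bar> powr p) \<partial>\<nu>) \<le> ennreal \<eta>"
      using exists_sampling_offset[OF sigma_finite_measure_cball[OF sets_nu fin] sets_nu _ d \<eta>'(1),
          of "\<lambda>z x. ennreal (\<bar>g f z - g f x\<bar> powr p)"] r(2)[OF f box_ball] \<eta>'(2) by simp
  qed
  then obtain t where t: "\<And>f. f \<in> F \<Longrightarrow>
      (\<integral>\<^sup>+ x. ennreal (\<bar>g f (cell d x + t f) - g f x\<bar> powr p) \<partial>\<nu>) \<le> ennreal \<eta>" by blast
  define s where "s f x = g f (cell d x + t f)" for f x
  have s_meas [measurable]: "s f \<in> borel_measurable \<nu>" if "f \<in> F" for f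
    using meas[OF that] unfolding s_def by measurable
  have g_meas [measurable]: "g f \<in> borel_measurable \<nu>" if "f \<in> F" for f
    using meas[OF that] by measurable
  define N where "N = cell d ` (ball 0 R :: 'a set)"
  have finN: "finite N" unfolding N_def by (rule finite_cell_image[OF d bounded_ball])
  define Q where "Q k = cell d -` {k}" for k :: 'a
  have Q_sets [measurable]: "Q k \<in> sets \<nu>" for k
  proof -
    have "cell d -` {k} \<inter> space borel \<in> sets borel" by measurable
    then show ?thesis by (simp add: sets_nu Q_def)
  qed
  have Q_fin: "emeasure \<nu> (Q k) < \<infinity>" for k
    using emeasure_mono[OF bounded_cell_vimage[OF d, of k], of \<nu>] fin sets_nu
    by (fastforce simp: Q_def intro: le_less_trans)
  define A where "A = (\<Sum>k\<in>N. measure \<nu> (Q k))"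
  have A0: "0 \<le> A" unfolding A_def by (intro sum_nonneg) auto
  define \<tau> where "\<tau> = (\<eta> / (A + 1)) powr (1 / p)"
  have \<tau>: "0 < \<tau>" "\<tau> powr p * A \<le> \<eta>"
    using \<eta> A0 p by (auto simp: \<tau>_def powr_powr divide_simps)
  define code where
    "code f k = (if k \<in> N \<and> measure \<nu> (Q k) \<noteq> 0 then \<lfloor>g f (k + t f) / \<tau>\<rfloor> else 0)" for f k
  have on_Q: "(\<integral>\<^sup>+ x. ennreal (\<bar>v (cell d x)\<bar> powr p) * indicator (Q k) x \<partial>\<nu>)
      = ennreal (\<bar>v k\<bar> powr p * measure \<nu> (Q k))" for v :: "'a \<Rightarrow> real" and k
  proof -
    have "(\<integral>\<^sup>+ x. ennreal (\<bar>v (cell d x)\<bar> powr p) * indicator (Q k) x \<partial>\<nu>)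
        = (\<integral>\<^sup>+ x. ennreal (\<bar>v k\<bar> powr p) * indicator (Q k) x \<partial>\<nu>)"
      by (intro nn_integral_cong) (auto simp: Q_def indicator_def)
    also have "\<dots> = ennreal (\<bar>v k\<bar> powr p) * emeasure \<nu> (Q k)"
      by (rule nn_integral_cmult_indicator) measurable
    finally show ?thesis
      using Q_fin[of k] by (simp add: ennreal_mult emeasure_eq_ennreal_measure less_top)
  qed
  have "finite (code ` F)"
  proof -
    define B where "B k = (c * (\<eta> + \<bar>M\<bar>) / measure \<nu> (Q k)) powr (1 / p) / \<tau>" for k
    let ?S = "insert 0 (\<Union>k\<in>N. {\<lfloor>- B k\<rfloor>..\<lfloor>B k\<rfloor>})"
    have "code f k \<in> ?S" if f: "f \<in> F" and k: "k \<in> N" for f k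
    proof (cases "measure \<nu> (Q k) = 0")
      case False
      then have Qpos: "0 < measure \<nu> (Q k)" by (simp add: zero_less_measure_iff)
      note [measurable] = f
      have "ennreal (\<bar>g f (k + t f)\<bar> powr p * measure \<nu> (Q k)) \<le> (\<integral>\<^sup>+ x. ennreal (\<bar>s f x\<bar> powr p) \<partial>\<nu>)"
        unfolding on_Q[of "\<lambda>k. g f (k + t f)", symmetric] s_def
        by (intro nn_integral_mono) (auto simp: indicator_def)
      also have "\<dots> = (\<integral>\<^sup>+ x. ennreal (\<bar>(s f x - g f x) + g f x\<bar> powr p) \<partial>\<nu>)" by simp
      also have "\<dots> \<le> ennreal c * ((\<integral>\<^sup>+ x. ennreal (\<bar>s f x - g f x\<bar> powr p) \<partial>\<nu>) + (\<integral>\<^sup>+ x. ennreal (\<bar>g f x\<bar> powr p) \<partial>\<nu>))"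
        by (rule quasi) measurable
      also have "\<dots> \<le> ennreal c * (ennreal \<eta> + ennreal \<bar>M\<bar>)"
        using t[OF f] bdd[OF f] unfolding s_def
        by (intro mult_left_mono add_mono) (auto intro: order_trans ennreal_leI)
      also have "\<dots> = ennreal (c * (\<eta> + \<bar>M\<bar>))" using c \<eta> by (simp add: ennreal_mult)
      finally have "\<bar>g f (k + t f)\<bar> powr p * measure \<nu> (Q k) \<le> c * (\<eta> + \<bar>M\<bar>)"
        using c \<eta> by (simp add: ennreal_le_iff)
      then have "\<bar>g f (k + t f)\<bar> powr p \<le> c * (\<eta> + \<bar>M\<bar>) / measure \<nu> (Q k)"
        using Qpos by (simp add: pos_le_divide_eq)
      then have "(\<bar>g f (k + t f)\<bar> powr p) powr (1 / p) \<le> B k * \<tau>"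
        unfolding B_def using \<tau> p by (simp add: powr_mono2)
      then have "\<bar>g f (k + t f)\<bar> \<le> B k * \<tau>" using p by (simp add: powr_powr)
      then have "\<bar>g f (k + t f) / \<tau>\<bar> \<le> B k" using \<tau> by (simp add: pos_divide_le_eq)
      then have "g f (k + t f) / \<tau> \<le> B k" "- B k \<le> g f (k + t f) / \<tau>" by linarith+
      then have "\<lfloor>g f (k + t f) / \<tau>\<rfloor> \<in> {\<lfloor>- B k\<rfloor>..\<lfloor>B k\<rfloor>}" by (auto intro!: floor_mono)
      then show ?thesis using k by (auto simp: code_def)
    qed (auto simp: code_def)
    then have "code ` F \<subseteq> {u. \<forall>k. (k \<in> N \<longrightarrow> u k \<in> ?S) \<and> (k \<notin> N \<longrightarrow> u k = 0)}"
    proof -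
      have "code f k = 0" if "k \<notin> N" for f k using that by (simp add: code_def)
      with \<open>\<And>f k. f \<in> F \<Longrightarrow> k \<in> N \<Longrightarrow> code f k \<in> ?S\<close> show ?thesis by blast
    qed
    moreover have "finite {u. \<forall>k. (k \<in> N \<longrightarrow> u k \<in> ?S) \<and> (k \<notin> N \<longrightarrow> u k = 0)}"
      by (rule finite_set_of_finite_funs) (use finN in auto)
    ultimately show ?thesis by (rule finite_subset)
  qed
  moreover have "(\<integral>\<^sup>+ x. ennreal (\<bar>g f x - g h x\<bar> powr p) \<partial>\<nu>) \<le> ennreal \<epsilon>"
    if f: "f \<in> F" and h: "h \<in> F" and eq: "code f = code h" for f h
  proof -
    note [measurable] = f h
    have cells: "(\<integral>\<^sup>+ x. ennreal (\<bar>s f x - s h x\<bar> powr p) * indicator (ball 0 R) x \<partial>\<nu>) \<le> ennreal \<eta>"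
    proof -
      let ?v = "\<lambda>k. g f (k + t f) - g h (k + t h)"
      have "(\<integral>\<^sup>+ x. ennreal (\<bar>s f x - s h x\<bar> powr p) * indicator (ball 0 R) x \<partial>\<nu>)
          \<le> (\<integral>\<^sup>+ x. (\<Sum>k\<in>N. ennreal (\<bar>?v (cell d x)\<bar> powr p) * indicator (Q k) x) \<partial>\<nu>)"
      proof (rule nn_integral_mono)
        fix x :: 'a
        have "ennreal (\<bar>?v (cell d x)\<bar> powr p) * indicator (Q (cell d x)) x
            \<le> (\<Sum>k\<in>N. ennreal (\<bar>?v (cell d x)\<bar> powr p) * indicator (Q k) x)" if "x \<in> ball 0 R"
          using that finN by (intro member_le_sum) (auto simp: N_def)
        then show "ennreal (\<bar>s f x - s h x\<bar> powr p) * indicator (ball 0 R) x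
            \<le> (\<Sum>k\<in>N. ennreal (\<bar>?v (cell d x)\<bar> powr p) * indicator (Q k) x)"
          by (auto simp: s_def Q_def indicator_def)
      qed
      also have "\<dots> = (\<Sum>k\<in>N. (\<integral>\<^sup>+ x. ennreal (\<bar>s f x - s h x\<bar> powr p) * indicator (Q k) x \<partial>\<nu>))"
        unfolding s_def[symmetric] by (rule nn_integral_sum) measurable
      also have "\<dots> = (\<Sum>k\<in>N. ennreal (\<bar>?v k\<bar> powr p * measure \<nu> (Q k)))"
        unfolding s_def by (simp only: on_Q[of ?v])
      also have "\<dots> = ennreal (\<Sum>k\<in>N. \<bar>?v k\<bar> powr p * measure \<nu> (Q k))"
        by (intro sum_ennreal) simp
      also have "\<dots> \<le> ennreal (\<Sum>k\<in>N. \<tau> powr p * measure \<nu> (Q k))"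
      proof (intro ennreal_leI sum_mono)
        fix k assume k: "k \<in> N"
        show "\<bar>?v k\<bar> powr p * measure \<nu> (Q k) \<le> \<tau> powr p * measure \<nu> (Q k)"
        proof (cases "measure \<nu> (Q k) = 0")
          case False
          then have "\<lfloor>g f (k + t f) / \<tau>\<rfloor> = \<lfloor>g h (k + t h) / \<tau>\<rfloor>"
            using fun_cong[OF eq, of k] k by (simp add: code_def)
          then have "\<bar>g f (k + t f) / \<tau> - g h (k + t h) / \<tau>\<bar> \<le> 1" by linarith
          then have "\<bar>?v k / \<tau>\<bar> \<le> 1" by (simp add: diff_divide_distrib)
          then have "\<bar>?v k\<bar> \<le> \<tau>" using \<tau> by (simp add: pos_divide_le_eq)
          then have "\<bar>?v k\<bar> powr p \<le> \<tau> powr p" using p by (intro powr_mono2) auto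
          then show ?thesis by (intro mult_right_mono) auto
        qed simp
      qed
      also have "\<dots> \<le> ennreal \<eta>"
        using \<tau>(2) by (simp add: A_def sum_distrib_left ennreal_leI)
      finally show ?thesis .
    qed
    let ?I = "\<lambda>u. (\<integral>\<^sup>+ x. ennreal (\<bar>u x\<bar> powr p) * indicator (ball 0 R) x \<partial>\<nu>)"
    let ?O = "\<lambda>u. (\<integral>\<^sup>+ x. ennreal (\<bar>u x\<bar> powr p) * indicator (- ball 0 R) x \<partial>\<nu>)"
    have restr: "(\<integral>\<^sup>+ x. ennreal (\<bar>u x + v x\<bar> powr p) * indicator S x \<partial>\<nu>) \<le>
       ennreal c * ((\<integral>\<^sup>+ x. ennreal (\<bar>u x\<bar> powr p) * indicator S x \<partial>\<nu>) + (\<integral>\<^sup>+ x. ennreal (\<bar>v x\<bar> powr p) * indicator S x \<partial>\<nu>))"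
      if [measurable]: "u \<in> borel_measurable \<nu>" "v \<in> borel_measurable \<nu>" "S \<in> sets \<nu>"
      for u v :: "'a \<Rightarrow> real" and S
    proof -
      have "u \<in> borel_measurable (restrict_space \<nu> S)" "v \<in> borel_measurable (restrict_space \<nu> S)"
        by (auto intro: measurable_restrict_space1 that)
      from quasi[OF this] show ?thesis
        using that(3) by (simp add: nn_integral_restrict_space)
    qed
    have [measurable]: "ball (0::'a) R \<in> sets \<nu>" "- ball (0::'a) R \<in> sets \<nu>"
      by (auto simp: sets_nu)
    have mono_ind: "(\<integral>\<^sup>+ x. ennreal (\<bar>u x\<bar> powr p) * indicator S x \<partial>\<nu>) \<le> (\<integral>\<^sup>+ x. ennreal (\<bar>u x\<bar> powr p) \<partial>\<nu>)"
      for u :: "'a \<Rightarrow> real" and S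
      by (intro nn_integral_mono) (auto simp: indicator_def)
    have Ig: "?I (\<lambda>x. s f' x - g f' x) \<le> ennreal \<eta>" if "f' \<in> F" for f'
      using order_trans[OF mono_ind t[OF that]] by (simp add: s_def)
    have "(\<integral>\<^sup>+ x. ennreal (\<bar>g f x - g h x\<bar> powr p) \<partial>\<nu>)
        = (\<integral>\<^sup>+ x. ennreal (\<bar>g f x - g h x\<bar> powr p) * indicator (ball 0 R) x
            + ennreal (\<bar>g f x - g h x\<bar> powr p) * indicator (- ball 0 R) x \<partial>\<nu>)"
      by (intro nn_integral_cong) (auto simp: indicator_def)
    also have "\<dots> = ?I (\<lambda>x. g f x - g h x) + ?O (\<lambda>x. g f x - g h x)"
      by (rule nn_integral_add) measurable
    also have "?O (\<lambda>x. g f x - g h x) = ?O (\<lambda>x. g f x + - g h x)" by simp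
    also have "\<dots> \<le> ennreal c * (?O (g f) + ?O (\<lambda>x. - g h x))"
      by (rule restr) measurable
    also have "?O (g f) \<le> ennreal \<eta>" by (rule R[OF f])
    also have "?O (\<lambda>x. - g h x) \<le> ennreal \<eta>" using R[OF h] by simp
    also have "?I (\<lambda>x. g f x - g h x) = ?I (\<lambda>x. (g f x - s f x) + ((s f x - s h x) + (s h x - g h x)))"
      by simp
    also have "\<dots> \<le> ennreal c * (?I (\<lambda>x. g f x - s f x) + ?I (\<lambda>x. (s f x - s h x) + (s h x - g h x)))"
      by (rule restr) measurable
    also have "?I (\<lambda>x. (s f x - s h x) + (s h x - g h x)) \<le> ennreal c * (?I (\<lambda>x. s f x - s h x) + ?I (\<lambda>x. s h x - g h x))"
      by (rule restr) measurable
    also have "?I (\<lambda>x. s f x - s h x) \<le> ennreal \<eta>" by (rule cells)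
    also have "?I (\<lambda>x. s h x - g h x) \<le> ennreal \<eta>" by (rule Ig[OF h])
    also have "?I (\<lambda>x. g f x - s f x) \<le> ennreal \<eta>" using Ig[OF f] by (simp add: abs_minus_commute)
    also have "ennreal c * (ennreal \<eta> + ennreal c * (ennreal \<eta> + ennreal \<eta>)) + ennreal c * (ennreal \<eta> + ennreal \<eta>)
        = ennreal (c * (\<eta> + c * (\<eta> + \<eta>)) + c * (\<eta> + \<eta>))"
      using c \<eta> by (simp add: ennreal_mult[symmetric] ennreal_plus[symmetric] del: ennreal_plus)
    also have "\<dots> \<le> ennreal \<epsilon>"
    proof (rule ennreal_leI)
      have "c * \<eta> \<le> c * c * \<eta>" using c \<eta> by (simp add: mult_right_mono)
      moreover have "c * c * \<eta> = \<epsilon> / 8" using c by (simp add: \<eta>_def)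
      ultimately show "c * (\<eta> + c * (\<eta> + \<eta>)) + c * (\<eta> + \<eta>) \<le> \<epsilon>"
        using \<epsilon> by (simp add: algebra_simps)
    qed
    finally show ?thesis by (simp add: add_mono mult_left_mono)
  qed
  ultimately show ?thesis by blast
qed

lemma AE_lborel_translate:
  fixes y :: "'a::euclidean_space"
  assumes "AE x in lborel. P x"
  shows "AE x in lborel. P (x - y)"
proof -
  obtain N where N: "N \<in> null_sets lborel" "{x \<in> space lborel. \<not> P x} \<subseteq> N"
    using assms by (auto simp: eventually_ae_filter)
  have [measurable]: "N \<in> sets borel" using N(1) by (simp add: null_sets_def)
  have "AE x in distr lborel borel ((+) (- y)). x \<notin> N"
    unfolding lborel_distr_plus by (rule AE_not_in[OF N(1)])
  then have "AE x in lborel. - y + x \<notin> N"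
    by (subst (asm) AE_distr_iff) auto
  then show ?thesis by (rule eventually_mono) (use N(2) in auto)
qed

lemma finite_code_of_precompact:
  fixes w :: "'a::euclidean_space \<Rightarrow> real" and g :: "'f \<Rightarrow> 'a \<Rightarrow> real"
  assumes p: "0 < p" and w_meas: "w \<in> borel_measurable lebesgue" and w0: "\<And>x. 0 \<le> w x"
    and fin: "\<And>R. (\<integral>\<^sup>+ x. ennreal (w x) * indicator (cball 0 R) x \<partial>lebesgue) < \<infinity>"
    and meas: "\<And>f. f \<in> F \<Longrightarrow> g f \<in> borel_measurable lebesgue"
    and bdd: "\<And>f. f \<in> F \<Longrightarrow> (\<integral>\<^sup>+ x. ennreal (w x * \<bar>g f x\<bar> powr p) \<partial>lebesgue) \<le> ennreal M"
    and tail: "\<And>\<eta>. 0 < \<eta> \<Longrightarrow>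
      \<exists>R. \<forall>f\<in>F. (\<integral>\<^sup>+ x. ennreal (w x * \<bar>g f x\<bar> powr p) * indicator (- ball 0 R) x \<partial>lebesgue) \<le> ennreal \<eta>"
    and trans: "\<And>\<eta>. 0 < \<eta> \<Longrightarrow>
      \<exists>r>0. \<forall>f\<in>F. \<forall>y\<in>ball 0 r.
        (\<integral>\<^sup>+ x. ennreal (w x * \<bar>g f (x - y) - g f x\<bar> powr p) \<partial>lebesgue) \<le> ennreal \<eta>"
    and \<epsilon>: "0 < \<epsilon>"
  shows "\<exists>code :: 'f \<Rightarrow> 'a \<Rightarrow> int. finite (code ` F) \<and> (\<forall>f\<in>F. \<forall>h\<in>F. code f = code h \<longrightarrow>
    (\<integral>\<^sup>+ x. ennreal (w x * \<bar>g f x - g h x\<bar> powr p) \<partial>lebesgue) \<le> ennreal \<epsilon>)"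
proof -
  obtain w' where w'[measurable]: "w' \<in> borel_measurable borel" and w'_eq: "AE x in lborel. w x = w' x"
    using completion_ex_borel_measurable_real[OF w_meas] by auto
  have "\<forall>f\<in>F. \<exists>g'. g' \<in> borel_measurable borel \<and> (AE x in lborel. g f x = g' x)"
    using completion_ex_borel_measurable_real[OF meas] by auto
  then obtain g' where g': "\<And>f. f \<in> F \<Longrightarrow> g' f \<in> borel_measurable borel"
      and g'_eq: "\<And>f. f \<in> F \<Longrightarrow> AE x in lborel. g f x = g' f x"
    by metis
  define \<nu> where "\<nu> = density lborel (\<lambda>x. ennreal (w' x))"
  have transfer: "(\<integral>\<^sup>+ x. \<psi> x \<partial>\<nu>) = (\<integral>\<^sup>+ x. ennreal (w x) * \<phi> x \<partial>lebesgue)"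
    if [measurable]: "\<psi> \<in> borel_measurable borel" and "AE x in lborel. \<phi> x = \<psi> x" for \<phi> \<psi> :: "'a \<Rightarrow> ennreal"
  proof -
    have "(\<integral>\<^sup>+ x. \<psi> x \<partial>\<nu>) = (\<integral>\<^sup>+ x. ennreal (w' x) * \<psi> x \<partial>lborel)"
      unfolding \<nu>_def by (rule nn_integral_density) auto
    also have "\<dots> = (\<integral>\<^sup>+ x. ennreal (w x) * \<phi> x \<partial>lborel)"
      using w'_eq that(2) by (intro nn_integral_cong_AE) auto
    finally show ?thesis by (simp add: nn_integral_completion)
  qed
  have ennw: "ennreal (w x * b) = ennreal (w x) * ennreal b" for x b
    by (rule ennreal_mult'[OF w0])
  have "\<exists>code :: 'f \<Rightarrow> 'a \<Rightarrow> int. finite (code ` F) \<and> (\<forall>f\<in>F. \<forall>h\<in>F. code f = code h \<longrightarrow>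
    (\<integral>\<^sup>+ x. ennreal (\<bar>g' f x - g' h x\<bar> powr p) \<partial>\<nu>) \<le> ennreal \<epsilon>)"
  proof (rule finite_code_of_precompact_borel[OF p _ _ g' _ _ _ \<epsilon>])
    show "sets \<nu> = sets borel" by (simp add: \<nu>_def)
    show "emeasure \<nu> (cball 0 R) < \<infinity>" for R
    proof -
      have "emeasure \<nu> (cball 0 R) = (\<integral>\<^sup>+ x. indicator (cball 0 R) x \<partial>\<nu>)"
        by (rule nn_integral_indicator[symmetric]) (simp add: \<nu>_def)
      also have "\<dots> = (\<integral>\<^sup>+ x. ennreal (w x) * indicator (cball 0 R) x \<partial>lebesgue)"
        by (rule transfer) (auto intro: borel_measurable_indicator)
      finally show ?thesis using fin by simp
    qed
    show "(\<integral>\<^sup>+ x. ennreal (\<bar>g' f x\<bar> powr p) \<partial>\<nu>) \<le> ennreal M" if f: "f \<in> F" for f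
      using bdd[OF f] g'[OF f] g'_eq[OF f] unfolding ennw
      by (subst transfer[where \<phi> = "\<lambda>x. ennreal (\<bar>g f x\<bar> powr p)"]) auto
    show "\<exists>R. \<forall>f\<in>F. (\<integral>\<^sup>+ x. ennreal (\<bar>g' f x\<bar> powr p) * indicator (- ball 0 R) x \<partial>\<nu>) \<le> ennreal \<eta>"
      if \<eta>: "0 < \<eta>" for \<eta>
    proof -
      obtain R where R: "\<And>f. f \<in> F \<Longrightarrow>
          (\<integral>\<^sup>+ x. ennreal (w x * \<bar>g f x\<bar> powr p) * indicator (- ball 0 R) x \<partial>lebesgue) \<le> ennreal \<eta>"
        using tail[OF \<eta>] by auto
      have "(\<integral>\<^sup>+ x. ennreal (\<bar>g' f x\<bar> powr p) * indicator (- ball 0 R) x \<partial>\<nu>) \<le> ennreal \<eta>" if f: "f \<in> F" for f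
        using R[OF f] g'[OF f] g'_eq[OF f] unfolding ennw mult.assoc
        by (subst transfer[where \<phi> = "\<lambda>x. ennreal (\<bar>g f x\<bar> powr p) * indicator (- ball 0 R) x"]) auto
      then show ?thesis by auto
    qed
    show "\<exists>r>0. \<forall>f\<in>F. \<forall>y\<in>ball 0 r. (\<integral>\<^sup>+ x. ennreal (\<bar>g' f (x - y) - g' f x\<bar> powr p) \<partial>\<nu>) \<le> ennreal \<eta>"
      if \<eta>: "0 < \<eta>" for \<eta>
    proof -
      obtain r where r: "0 < r" "\<And>f y. f \<in> F \<Longrightarrow> y \<in> ball 0 r \<Longrightarrow>
          (\<integral>\<^sup>+ x. ennreal (w x * \<bar>g f (x - y) - g f x\<bar> powr p) \<partial>lebesgue) \<le> ennreal \<eta>"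
        using trans[OF \<eta>] by auto
      have "(\<integral>\<^sup>+ x. ennreal (\<bar>g' f (x - y) - g' f x\<bar> powr p) \<partial>\<nu>) \<le> ennreal \<eta>"
        if f: "f \<in> F" and y: "y \<in> ball 0 r" for f y
      proof -
        note [measurable] = g'[OF f]
        have "AE x in lborel. ennreal (\<bar>g f (x - y) - g f x\<bar> powr p) = ennreal (\<bar>g' f (x - y) - g' f x\<bar> powr p)"
          using g'_eq[OF f] AE_lborel_translate[OF g'_eq[OF f], of y] by eventually_elim simp
        then show ?thesis
          using r(2)[OF f y] unfolding ennw by (subst transfer) auto
      qed
      then show ?thesis using r(1) by auto
    qed
  qed auto
  then obtain code :: "'f \<Rightarrow> 'a \<Rightarrow> int" where code: "finite (code ` F)"
    "\<And>f h. f \<in> F \<Longrightarrow> h \<in> F \<Longrightarrow> code f = code h \<Longrightarrow>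
      (\<integral>\<^sup>+ x. ennreal (\<bar>g' f x - g' h x\<bar> powr p) \<partial>\<nu>) \<le> ennreal \<epsilon>" by blast
  have "(\<integral>\<^sup>+ x. ennreal (w x * \<bar>g f x - g h x\<bar> powr p) \<partial>lebesgue) \<le> ennreal \<epsilon>"
    if f: "f \<in> F" and h: "h \<in> F" and eq: "code f = code h" for f h
  proof -
    note [measurable] = g'[OF f] g'[OF h]
    have "AE x in lborel. ennreal (\<bar>g f x - g h x\<bar> powr p) = ennreal (\<bar>g' f x - g' h x\<bar> powr p)"
      using g'_eq[OF f] g'_eq[OF h] by eventually_elim simp
    then show ?thesis
      using code(2)[OF f h eq] unfolding ennw by (subst (asm) transfer) auto
  qed
  then show ?thesis using code(1) by blast
qed

lemma diag_mat_mult_left: "(diag_mat l ** A) $ i $ j = l i * A $ i $ j"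
  by (simp add: matrix_matrix_mult_def diag_mat_def if_distrib if_distribR sum.delta cong: if_cong)

lemma diag_mat_mult_right: "(A ** diag_mat l) $ i $ j = A $ i $ j * l j"
  by (simp add: matrix_matrix_mult_def diag_mat_def if_distrib if_distribR sum.delta' cong: if_cong)

lemma diag_mat_mult_vec: "(diag_mat l *v v) $ i = l i * v $ i"
  by (simp add: matrix_vector_mult_def diag_mat_def if_distrib if_distribR sum.delta cong: if_cong)

text \<open>The entries of \<open>M = V'\<^sup>H V\<close> vanish unless \<open>l j = l' i\<close>, so \<open>M\<close> intertwines
  every function of the two spectra.\<close>

lemma spectral_function_unique:
  fixes V V' :: "'d::finite cmat" and l l' :: "'d \<Rightarrow> real" and \<phi> :: "real \<Rightarrow> real"
  assumes V: "unitary V" and V': "unitary V'"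
    and eq: "V ** diag_mat (\<lambda>i. complex_of_real (l i)) ** adj V = V' ** diag_mat (\<lambda>i. complex_of_real (l' i)) ** adj V'"
  shows "V ** diag_mat (\<lambda>i. complex_of_real (\<phi> (l i))) ** adj V
       = V' ** diag_mat (\<lambda>i. complex_of_real (\<phi> (l' i))) ** adj V'"
proof -
  have VV: "adj V ** V = mat 1" "V ** adj V = mat 1" and VV': "adj V' ** V' = mat 1" "V' ** adj V' = mat 1"
    using V V' by (auto simp: unitary_def)
  let ?M = "adj V' ** V"
  have "adj V' ** (V ** diag_mat (\<lambda>i. complex_of_real (l i)) ** adj V) ** V
      = adj V' ** (V' ** diag_mat (\<lambda>i. complex_of_real (l' i)) ** adj V') ** V"
    by (simp only: eq)
  then have "?M ** diag_mat (\<lambda>i. complex_of_real (l i)) ** (adj V ** V)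
      = (adj V' ** V') ** diag_mat (\<lambda>i. complex_of_real (l' i)) ** ?M"
    by (simp only: matrix_mul_assoc)
  then have M: "?M ** diag_mat (\<lambda>i. complex_of_real (l i)) = diag_mat (\<lambda>i. complex_of_real (l' i)) ** ?M"
    by (simp only: VV VV' matrix_mul_lid matrix_mul_rid)
  have "?M $ i $ j = 0 \<or> l j = l' i" for i j
    using arg_cong[OF M, of "\<lambda>A. A $ i $ j"]
    by (auto simp: diag_mat_mult_left diag_mat_mult_right)
  then have "?M ** diag_mat (\<lambda>i. complex_of_real (\<phi> (l i))) = diag_mat (\<lambda>i. complex_of_real (\<phi> (l' i))) ** ?M"
    by (auto simp: vec_eq_iff diag_mat_mult_left diag_mat_mult_right) metis
  then have "V' ** (?M ** diag_mat (\<lambda>i. complex_of_real (\<phi> (l i)))) ** adj V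
      = V' ** (diag_mat (\<lambda>i. complex_of_real (\<phi> (l' i))) ** ?M) ** adj V"
    by simp
  then have "(V' ** adj V') ** (V ** diag_mat (\<lambda>i. complex_of_real (\<phi> (l i))) ** adj V)
      = V' ** diag_mat (\<lambda>i. complex_of_real (\<phi> (l' i))) ** adj V' ** (V ** adj V)"
    by (simp only: matrix_mul_assoc)
  then show ?thesis by (simp only: VV VV' matrix_mul_lid matrix_mul_rid)
qed

lemma mpow_eq:
  assumes "unitary V" "\<And>i. 0 \<le> l i" "A = V ** diag_mat (\<lambda>i. complex_of_real (l i)) ** adj V"
  shows "mpow A s = V ** diag_mat (\<lambda>i. complex_of_real (l i powr s)) ** adj V"
  unfolding mpow_def
proof (rule the_equality)
  fix B assume "\<exists>V (l :: _ \<Rightarrow> real). unitary V \<and> (\<forall>i. 0 \<le> l i) \<and>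
       A = V ** diag_mat (\<lambda>i. complex_of_real (l i)) ** adj V \<and>
       B = V ** diag_mat (\<lambda>i. complex_of_real (l i powr s)) ** adj V"
  then show "B = V ** diag_mat (\<lambda>i. complex_of_real (l i powr s)) ** adj V"
    using assms spectral_function_unique[of V _ l _ "\<lambda>x. x powr s"] by metis
qed (use assms in blast)

lemma adj_mult_vec_inner:
  "(\<Sum>i\<in>UNIV. cnj (u $ i) * (adj A *v v) $ i) = (\<Sum>i\<in>UNIV. cnj ((A *v u) $ i) * v $ i)"
  (is "?l = ?r")
proof -
  have "?l = (\<Sum>i\<in>UNIV. \<Sum>j\<in>UNIV. cnj (u $ i) * (cnj (A $ j $ i) * v $ j))"
    by (simp add: matrix_vector_mult_def adj_def sum_distrib_left)
  also have "\<dots> = (\<Sum>j\<in>UNIV. \<Sum>i\<in>UNIV. cnj (u $ i) * (cnj (A $ j $ i) * v $ j))"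
    by (rule sum.swap)
  also have "\<dots> = ?r"
    by (simp add: matrix_vector_mult_def sum_distrib_right sum_distrib_left mult_ac)
  finally show ?thesis .
qed

lemma norm_cvec_sq:
  fixes v :: "'d::finite cvec"
  shows "complex_of_real ((norm v)\<^sup>2) = (\<Sum>i\<in>UNIV. cnj (v $ i) * v $ i)"
proof -
  have "(norm v)\<^sup>2 = (\<Sum>i\<in>UNIV. (norm (v $ i))\<^sup>2)"
    by (simp add: norm_vec_def L2_set_def sum_nonneg)
  then show ?thesis by (simp add: complex_norm_square mult.commute del: of_real_power)
qed

lemma norm_unitary:
  assumes "unitary V"
  shows "norm (V *v v) = norm v"
proof -
  have "complex_of_real ((norm (V *v v))\<^sup>2) = complex_of_real ((norm v)\<^sup>2)"
    unfolding norm_cvec_sq using adj_mult_vec_inner[of v V "V *v v"] assms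
    by (simp add: matrix_vector_mul_assoc unitary_def)
  then have "(norm (V *v v))\<^sup>2 = (norm v)\<^sup>2" by (simp only: of_real_eq_iff)
  then show ?thesis by (simp add: power2_eq_iff_nonneg)
qed

lemma diagonalizer_psd:
  assumes A: "psd A" and V: "unitary V" and D: "is_diagonal (adj V ** A ** V)"
  defines "l \<equiv> \<lambda>i. Re ((adj V ** A ** V) $ i $ i)"
  shows "A = V ** diag_mat (\<lambda>i. complex_of_real (l i)) ** adj V"
    and "0 \<le> l i"
    and "l i \<le> onorm (\<lambda>v. A *v v)"
proof -
  have VV: "adj V ** V = mat 1" "V ** adj V = mat 1" using V by (auto simp: unitary_def)
  have q: "Im ((adj V ** A ** V) $ i $ i) = 0 \<and> 0 \<le> l i" for i
  proof -
    let ?e = "axis i 1 :: 'a cvec"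
    have "(adj V ** A ** V) $ i $ i = (\<Sum>k\<in>UNIV. cnj (?e $ k) * (adj V *v (A *v (V *v ?e))) $ k)"
      by (simp add: axis_def if_distrib if_distribR matrix_vector_mul_assoc cong: if_cong)
        (simp add: matrix_vector_mult_def if_distrib if_distribR matrix_mul_assoc cong: if_cong)
    also have "\<dots> = (\<Sum>k\<in>UNIV. cnj ((V *v ?e) $ k) * (A *v (V *v ?e)) $ k)"
      by (rule adj_mult_vec_inner)
    finally show ?thesis
      using A unfolding psd_def l_def Let_def by metis
  qed
  then show "0 \<le> l i" by simp
  have D': "adj V ** A ** V = diag_mat (\<lambda>i. complex_of_real (l i))"
  proof -
    have "(adj V ** A ** V) $ i $ j = diag_mat (\<lambda>i. complex_of_real (l i)) $ i $ j" for i j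
      using D q[of i] by (auto simp: is_diagonal_def diag_mat_def l_def complex_eq_iff)
    then show ?thesis by (simp add: vec_eq_iff)
  qed
  have "V ** (adj V ** A ** V) ** adj V = (V ** adj V) ** A ** (V ** adj V)"
    by (simp only: matrix_mul_assoc)
  then show *: "A = V ** diag_mat (\<lambda>i. complex_of_real (l i)) ** adj V"
    by (simp only: D' VV matrix_mul_lid matrix_mul_rid)
  let ?v = "V *v axis i 1"
  have "adj V *v ?v = axis i 1" by (simp add: matrix_vector_mul_assoc VV)
  then have "A *v ?v = V *v (diag_mat (\<lambda>i. complex_of_real (l i)) *v axis i 1)"
    by (subst *) (simp add: matrix_vector_mul_assoc[symmetric])
  also have "diag_mat (\<lambda>i. complex_of_real (l i)) *v axis i 1 = l i *\<^sub>R axis i 1"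
    by (auto simp: vec_eq_iff diag_mat_mult_vec axis_def) (simp_all add: scaleR_conv_of_real)
  finally have "norm (A *v ?v) = l i"
    using norm_unitary[OF V] q[of i] by simp
  moreover have "norm ?v = 1" using norm_unitary[OF V] by simp
  moreover have "bounded_linear (\<lambda>v. A *v v)"
    by (rule matrix_vector_mul_bounded_linear)
  ultimately show "l i \<le> onorm (\<lambda>v. A *v v)"
    using onorm[of "\<lambda>v. A *v v" ?v] by simp
qed

lemma epow_le_iff_powr:
  assumes "0 < p" "0 \<le> b"
  shows "epow a (1 / p) \<le> ennreal b \<longleftrightarrow> a \<le> ennreal (b powr p)"
proof (cases a)
  case (real r)
  have "r powr (1 / p) \<le> b \<longleftrightarrow> r \<le> b powr p"
  proof
    assume "r powr (1 / p) \<le> b"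
    then have "(r powr (1 / p)) powr p \<le> b powr p" using assms by (intro powr_mono2) auto
    then show "r \<le> b powr p" using assms real by (simp add: powr_powr)
  next
    assume "r \<le> b powr p"
    then have "r powr (1 / p) \<le> (b powr p) powr (1 / p)" using assms real by (intro powr_mono2) auto
    then show "r powr (1 / p) \<le> b" using assms by (simp add: powr_powr)
  qed
  then show ?thesis using real assms by (simp add: epow_def)
qed (simp add: epow_def top_unique)

lemma borel_measurable_cmat_nth:
  assumes "A \<in> borel_measurable M"
  shows "(\<lambda>x. (A x :: 'd::finite cmat) $ i $ j) \<in> borel_measurable M"
  by (rule measurable_compose[OF assms borel_measurable_continuous_onI]) (intro continuous_intros)

lemma borel_measurable_cvec_nth:
  assumes "f \<in> borel_measurable M"
  shows "(\<lambda>x. (f x :: 'd::finite cvec) $ i) \<in> borel_measurable M"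
  by (rule measurable_compose[OF assms borel_measurable_continuous_onI]) (intro continuous_intros)

fun real_coord :: "'d::finite \<times> bool \<Rightarrow> 'd cvec \<Rightarrow> real" where
  "real_coord (i, b) v = (if b then Re (v $ i) else Im (v $ i))"

lemma real_coord_diff: "real_coord j (u - v) = real_coord j u - real_coord j v"
  by (cases j) auto

lemma real_coord_le_norm_diag:
  fixes l :: "'d::finite \<Rightarrow> real"
  assumes "0 < p" "\<And>i. 0 \<le> l i"
  shows "l (fst j) * \<bar>real_coord j u\<bar> powr p
    \<le> norm (diag_mat (\<lambda>i. complex_of_real (l i powr (1 / p))) *v u) powr p"
proof -
  let ?D = "diag_mat (\<lambda>i. complex_of_real (l i powr (1 / p)))"
  have "\<bar>real_coord j u\<bar> \<le> norm (u $ fst j)"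
    by (cases j) (auto simp: abs_Re_le_cmod abs_Im_le_cmod)
  then have "l (fst j) * \<bar>real_coord j u\<bar> powr p \<le> l (fst j) * norm (u $ fst j) powr p"
    using assms by (intro mult_left_mono powr_mono2) auto
  also have "\<dots> = norm ((?D *v u) $ fst j) powr p"
    using assms by (simp add: diag_mat_mult_vec norm_mult powr_mult powr_powr)
  also have "\<dots> \<le> norm (?D *v u) powr p"
    using assms by (intro powr_mono2 Finite_Cartesian_Product.norm_nth_le) auto
  finally show ?thesis .
qed

lemma norm_diag_le_real_coords:
  fixes l :: "'d::finite \<Rightarrow> real"
  assumes p: "0 < p" and l: "\<And>i. 0 \<le> l i"
  shows "norm (diag_mat (\<lambda>i. complex_of_real (l i powr (1 / p))) *v u) powr p
    \<le> real CARD('d \<times> bool) powr p * (\<Sum>j\<in>UNIV. l (fst j) * \<bar>real_coord j u\<bar> powr p)"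
proof -
  have "norm (diag_mat (\<lambda>i. complex_of_real (l i powr (1 / p))) *v u)
      \<le> (\<Sum>i\<in>UNIV. norm ((diag_mat (\<lambda>i. complex_of_real (l i powr (1 / p))) *v u) $ i))"
    by (simp add: norm_vec_def L2_set_le_sum)
  also have "\<dots> \<le> (\<Sum>i\<in>UNIV. l i powr (1 / p) * (\<bar>Re (u $ i)\<bar> + \<bar>Im (u $ i)\<bar>))"
    by (intro sum_mono) (auto simp: diag_mat_mult_vec norm_mult intro!: mult_left_mono cmod_le)
  also have "\<dots> = (\<Sum>i\<in>UNIV. \<Sum>b\<in>UNIV. l i powr (1 / p) * \<bar>real_coord (i, b) u\<bar>)"
    by (simp add: UNIV_bool algebra_simps)
  also have "\<dots> = (\<Sum>j\<in>UNIV. l (fst j) powr (1 / p) * \<bar>real_coord j u\<bar>)"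
    unfolding sum.cartesian_product UNIV_Times_UNIV
    by (intro sum.cong) auto
  finally have "norm (diag_mat (\<lambda>i. complex_of_real (l i powr (1 / p))) *v u) powr p
      \<le> (\<Sum>j\<in>UNIV. l (fst j) powr (1 / p) * \<bar>real_coord j u\<bar>) powr p"
    using p by (intro powr_mono2) auto
  also have "\<dots> \<le> real CARD('d \<times> bool) powr p * (\<Sum>j\<in>UNIV. (l (fst j) powr (1 / p) * \<bar>real_coord j u\<bar>) powr p)"
    by (rule powr_sum_le) (use p in auto)
  also have "(\<Sum>j\<in>UNIV. (l (fst j) powr (1 / p) * \<bar>real_coord j u\<bar>) powr p)
      = (\<Sum>j\<in>UNIV. l (fst j) * \<bar>real_coord j u\<bar> powr p)"
    using p l by (intro sum.cong) (auto simp: powr_mult powr_powr)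
  finally show ?thesis .
qed

theorem theorem3p6:
  fixes p :: real
    and W U :: "real^'n::finite \<Rightarrow> complex^'d::finite^'d"
    and F :: "(real^'n \<Rightarrow> complex^'d) set"
  assumes p: "0 < p"
    and W: "matrix_weight W"
    and U_meas: "U \<in> borel_measurable lebesgue"
    and U_unit: "\<forall>x. unitary (U x)"
    and U_diag: "\<forall>x. is_diagonal (adj (U x) ** W x ** U x)"
    and F_sub: "F \<subseteq> LpW p W"
    and a: "(SUP f\<in>F. Lpw_norm p W f) < \<infinity>"
    and b: "((\<lambda>R. SUP f\<in>F. Lpw_norm p W (\<lambda>x. if x \<in> - ball 0 R then f x else 0))
              \<longlongrightarrow> 0) at_top"
    and c: "((\<lambda>r. SUP f\<in>F. SUP y\<in>ball 0 r.
               epow (\<integral>\<^sup>+ x. ennreal (norm ((adj (U x) ** mpow (W x) (1/p) ** U x)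
                   *v (adj (U (x - y)) *v f (x - y) - adj (U x) *v f x)) powr p) \<partial>lebesgue) (1/p))
              \<longlongrightarrow> 0) (at_right 0)"
  shows "LpW_totally_bounded p W F"
proof -
  define l where "l i x = Re ((adj (U x) ** W x ** U x) $ i $ i)" for i x
  define D where "D x = diag_mat (\<lambda>i. complex_of_real (l i x powr (1 / p)))" for x
  define g where "g f x = adj (U x) *v f x" for f x
  have psd: "psd (W x)" for x using W by (simp add: matrix_weight_def)
  note spectral = diagonalizer_psd[OF psd U_unit[rule_format] U_diag[rule_format], folded l_def]
  have l0: "0 \<le> l i x" for i x by (rule spectral(2))
  have UU: "adj (U x) ** U x = mat 1" "U x ** adj (U x) = mat 1" for x
    using U_unit by (auto simp: unitary_def)
  have mpow: "mpow (W x) (1 / p) = U x ** D x ** adj (U x)" for x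
    unfolding D_def using mpow_eq[OF U_unit[rule_format] l0 spectral(1)] .
  have conj: "adj (U x) ** mpow (W x) (1 / p) ** U x = D x" for x
  proof -
    have "adj (U x) ** (U x ** D x ** adj (U x)) ** U x = (adj (U x) ** U x) ** D x ** (adj (U x) ** U x)"
      by (simp only: matrix_mul_assoc)
    then show ?thesis by (simp add: mpow UU matrix_mul_lid matrix_mul_rid)
  qed
  have norm_mpow: "norm (mpow (W x) (1 / p) *v v) = norm (D x *v (adj (U x) *v v))" for x v
    unfolding mpow using norm_unitary[of "U x" "D x *v (adj (U x) *v v)"] U_unit
    by (simp add: matrix_vector_mul_assoc matrix_mul_assoc)
  have coord_le: "l (fst j) x * \<bar>real_coord j u\<bar> powr p \<le> norm (D x *v u) powr p" for j x u
    unfolding D_def using real_coord_le_norm_diag[OF p, of "\<lambda>i. l i x"] l0 by auto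
  have W_meas: "W \<in> borel_measurable lebesgue" using W by (simp add: matrix_weight_def)
  note [measurable] = borel_measurable_cmat_nth[OF W_meas] borel_measurable_cmat_nth[OF U_meas]
  have [measurable]: "(\<lambda>x. cnj (U x $ i $ k)) \<in> borel_measurable lebesgue" for i k
    by (rule measurable_compose[OF borel_measurable_cmat_nth[OF U_meas] borel_measurable_continuous_onI])
      (intro continuous_intros)
  have l_meas [measurable]: "l i \<in> borel_measurable lebesgue" for i
    unfolding l_def[abs_def] matrix_matrix_mult_def adj_def by simp
  have g_meas: "(\<lambda>x. real_coord j (g f x)) \<in> borel_measurable lebesgue" if "f \<in> F" for j f
  proof -
    have "f \<in> borel_measurable lebesgue" using that F_sub by (auto simp: LpW_def)
    note [measurable] = borel_measurable_cvec_nth[OF this]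
    have "(\<lambda>x. g f x $ i) \<in> borel_measurable lebesgue" for i
      unfolding g_def matrix_vector_mult_def adj_def by simp
    then show ?thesis by (cases j; cases "snd j") auto
  qed
  have code: "\<exists>code :: (real^'n \<Rightarrow> complex^'d) \<Rightarrow> real^'n \<Rightarrow> int. finite (code ` F) \<and>
      (\<forall>f\<in>F. \<forall>h\<in>F. code f = code h \<longrightarrow>
        (\<integral>\<^sup>+ x. ennreal (l (fst j) x * \<bar>real_coord j (g f x) - real_coord j (g h x)\<bar> powr p) \<partial>lebesgue) \<le> ennreal \<epsilon>)"
    if "0 < \<epsilon>" for \<epsilon> and j :: "'d \<times> bool"
  proof -
    obtain M0 where M0: "0 \<le> M0" "(SUP f\<in>F. Lpw_norm p W f) = ennreal M0"
      using a by (cases "SUP f\<in>F. Lpw_norm p W f") auto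
    show ?thesis
    proof (rule finite_code_of_precompact[OF p l_meas l0 _ g_meas _ _ _ that])
      show "(\<integral>\<^sup>+ x. ennreal (l (fst j) x) * indicator (cball 0 R) x \<partial>lebesgue) < \<infinity>" for R
      proof -
        have "set_integrable lebesgue (cball 0 R) (\<lambda>x. onorm (\<lambda>v. W x *v v))"
          using W by (simp add: matrix_weight_def)
        then have "(\<integral>\<^sup>+ x. ennreal (norm (indicator (cball 0 R) x *\<^sub>R onorm (\<lambda>v. W x *v v))) \<partial>lebesgue) < \<infinity>"
          by (simp add: set_integrable_def integrable_iff_bounded)
        moreover have "(\<integral>\<^sup>+ x. ennreal (l (fst j) x) * indicator (cball 0 R) x \<partial>lebesgue)
            \<le> (\<integral>\<^sup>+ x. ennreal (norm (indicator (cball 0 R) x *\<^sub>R onorm (\<lambda>v. W x *v v))) \<partial>lebesgue)"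
          using spectral(3) by (intro nn_integral_mono) (auto simp: indicator_def intro!: ennreal_leI order_trans[OF _ abs_ge_self])
        ultimately show ?thesis by (rule le_less_trans[rotated])
      qed
      show "(\<integral>\<^sup>+ x. ennreal (l (fst j) x * \<bar>real_coord j (g f x)\<bar> powr p) \<partial>lebesgue) \<le> ennreal (M0 powr p)"
        if "f \<in> F" for f
      proof -
        have "Lpw_norm p W f \<le> ennreal M0" unfolding M0(2)[symmetric] using that by (rule SUP_upper)
        then have "(\<integral>\<^sup>+ x. ennreal (norm (D x *v g f x) powr p) \<partial>lebesgue) \<le> ennreal (M0 powr p)"
          unfolding Lpw_norm_def norm_mpow epow_le_iff_powr[OF p M0(1)] g_def .
        then show ?thesis
          by (rule order_trans[rotated]) (intro nn_integral_mono ennreal_leI coord_le)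
      qed
      show "\<exists>R. \<forall>f\<in>F. (\<integral>\<^sup>+ x. ennreal (l (fst j) x * \<bar>real_coord j (g f x)\<bar> powr p)
          * indicator (- ball 0 R) x \<partial>lebesgue) \<le> ennreal \<eta>" if \<eta>: "0 < \<eta>" for \<eta>
      proof -
        have "0 < ennreal (\<eta> powr (1 / p))" using \<eta> by simp
        from order_tendstoD(2)[OF b this] obtain R where
          R: "(SUP f\<in>F. Lpw_norm p W (\<lambda>x. if x \<in> - ball 0 R then f x else 0)) < ennreal (\<eta> powr (1 / p))"
          by (auto dest: eventually_happens)
        have "(\<integral>\<^sup>+ x. ennreal (l (fst j) x * \<bar>real_coord j (g f x)\<bar> powr p)
          * indicator (- ball 0 R) x \<partial>lebesgue) \<le> ennreal \<eta>" if f: "f \<in> F" for f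
        proof -
          let ?f = "\<lambda>x. if x \<in> - ball 0 R then f x else 0"
          have "Lpw_norm p W ?f \<le> ennreal (\<eta> powr (1 / p))"
            using less_imp_le[OF R] f by (simp only: SUP_le_iff)
          then have "(\<integral>\<^sup>+ x. ennreal (norm (D x *v (adj (U x) *v ?f x)) powr p) \<partial>lebesgue) \<le> ennreal \<eta>"
            unfolding Lpw_norm_def norm_mpow epow_le_iff_powr[OF p powr_ge_zero] using p \<eta> by (simp add: powr_powr)
          moreover have pointwise: "ennreal (l (fst j) x * \<bar>real_coord j (g f x)\<bar> powr p) * indicator (- ball 0 R) x
              \<le> ennreal (norm (D x *v (adj (U x) *v ?f x)) powr p)" for x
            using coord_le[of j x "g f x"] by (auto simp: g_def indicator_def intro!: ennreal_leI)
          ultimately show ?thesis by (elim order_trans[rotated]) (intro nn_integral_mono pointwise)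
        qed
        then show ?thesis by blast
      qed
      show "\<exists>r>0. \<forall>f\<in>F. \<forall>y\<in>ball 0 r. (\<integral>\<^sup>+ x. ennreal (l (fst j) x *
          \<bar>real_coord j (g f (x - y)) - real_coord j (g f x)\<bar> powr p) \<partial>lebesgue) \<le> ennreal \<eta>" if \<eta>: "0 < \<eta>" for \<eta>
      proof -
        have "0 < ennreal (\<eta> powr (1 / p))" using \<eta> by simp
        from order_tendstoD(2)[OF c this] obtain r' where r': "0 < r'" "\<And>r. 0 < r \<Longrightarrow> r < r' \<Longrightarrow>
            (SUP f\<in>F. SUP y\<in>ball 0 r.
               epow (\<integral>\<^sup>+ x. ennreal (norm (D x *v (g f (x - y) - g f x)) powr p) \<partial>lebesgue) (1/p))
              < ennreal (\<eta> powr (1 / p))"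
          unfolding conj eventually_at_right_field g_def by blast
        define r where "r = r' / 2"
        have r: "0 < r" "(SUP f\<in>F. SUP y\<in>ball 0 r.
               epow (\<integral>\<^sup>+ x. ennreal (norm (D x *v (g f (x - y) - g f x)) powr p) \<partial>lebesgue) (1/p))
              < ennreal (\<eta> powr (1 / p))"
          using r'(1) r'(2)[of r] by (simp_all add: r_def)
        have "(\<integral>\<^sup>+ x. ennreal (l (fst j) x *
          \<bar>real_coord j (g f (x - y)) - real_coord j (g f x)\<bar> powr p) \<partial>lebesgue) \<le> ennreal \<eta>"
          if f: "f \<in> F" and y: "y \<in> ball 0 r" for f y
        proof -
          have "epow (\<integral>\<^sup>+ x. ennreal (norm (D x *v (g f (x - y) - g f x)) powr p) \<partial>lebesgue) (1/p)
              \<le> ennreal (\<eta> powr (1 / p))"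
            using less_imp_le[OF r(2)] f y by (simp only: SUP_le_iff)
          then have "(\<integral>\<^sup>+ x. ennreal (norm (D x *v (g f (x - y) - g f x)) powr p) \<partial>lebesgue) \<le> ennreal \<eta>"
            unfolding epow_le_iff_powr[OF p powr_ge_zero] using p \<eta> by (simp add: powr_powr)
          then show ?thesis
            by (rule order_trans[rotated])
              (intro nn_integral_mono ennreal_leI, simp only: real_coord_diff[symmetric] coord_le)
        qed
        then show ?thesis using r(1) by blast
      qed
    qed auto
  qed
  show ?thesis
    unfolding LpW_totally_bounded_def
  proof (intro allI impI)
    fix e :: real assume e: "0 < e"
    let ?n = "real CARD('d \<times> bool)"
    have n: "0 < ?n" by simp
    define \<epsilon> where "\<epsilon> = (e / 2) powr p / (?n powr p * ?n)"
    have \<epsilon>: "0 < \<epsilon>" using e n unfolding \<epsilon>_def by (intro divide_pos_pos mult_pos_pos) auto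
    have "\<exists>C :: 'd \<times> bool \<Rightarrow> (real^'n \<Rightarrow> complex^'d) \<Rightarrow> real^'n \<Rightarrow> int. \<forall>j. finite (C j ` F) \<and>
        (\<forall>f\<in>F. \<forall>h\<in>F. C j f = C j h \<longrightarrow> (\<integral>\<^sup>+ x. ennreal (l (fst j) x *
          \<bar>real_coord j (g f x) - real_coord j (g h x)\<bar> powr p) \<partial>lebesgue) \<le> ennreal \<epsilon>)"
      by (intro choice allI code \<epsilon>)
    then obtain C :: "'d \<times> bool \<Rightarrow> (real^'n \<Rightarrow> complex^'d) \<Rightarrow> real^'n \<Rightarrow> int" where
      C_fin: "\<And>j. finite (C j ` F)" and
      C: "\<And>j f h. f \<in> F \<Longrightarrow> h \<in> F \<Longrightarrow> C j f = C j h \<Longrightarrow>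
        (\<integral>\<^sup>+ x. ennreal (l (fst j) x * \<bar>real_coord j (g f x) - real_coord j (g h x)\<bar> powr p) \<partial>lebesgue) \<le> ennreal \<epsilon>"
      by blast
    let ?C = "\<lambda>f j. C j f"
    have "?C ` F \<subseteq> PiE UNIV (\<lambda>j. C j ` F)" by auto
    then have "finite (?C ` F)"
      by (rule finite_subset) (intro finite_PiE finite C_fin)
    then obtain K where K: "K \<subseteq> F" "finite K" "?C ` F = ?C ` K"
      using finite_subset_image[of "?C ` F" ?C F] by blast
    have close: "Lpw_norm p W (\<lambda>x. f x - h x) < ennreal e"
      if f: "f \<in> F" and h: "h \<in> F" and eq: "?C f = ?C h" for f h
    proof -
      note [measurable] = g_meas[OF f] g_meas[OF h]
      have "(\<integral>\<^sup>+ x. ennreal (norm (mpow (W x) (1/p) *v (f x - h x)) powr p) \<partial>lebesgue)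
          \<le> (\<integral>\<^sup>+ x. ennreal (?n powr p) * (\<Sum>j\<in>UNIV. ennreal (l (fst j) x *
              \<bar>real_coord j (g f x) - real_coord j (g h x)\<bar> powr p)) \<partial>lebesgue)"
      proof (rule nn_integral_mono)
        fix x
        have "norm (mpow (W x) (1/p) *v (f x - h x)) powr p
            \<le> ?n powr p * (\<Sum>j\<in>UNIV. l (fst j) x * \<bar>real_coord j (g f x) - real_coord j (g h x)\<bar> powr p)"
          unfolding norm_mpow D_def real_coord_diff[symmetric] g_def matrix_vector_mult_diff_distrib[symmetric]
          by (rule norm_diag_le_real_coords[OF p l0])
        then show "ennreal (norm (mpow (W x) (1/p) *v (f x - h x)) powr p)
            \<le> ennreal (?n powr p) * (\<Sum>j\<in>UNIV. ennreal (l (fst j) x *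
              \<bar>real_coord j (g f x) - real_coord j (g h x)\<bar> powr p))"
          using l0 by (subst sum_ennreal) (auto simp: ennreal_mult'[symmetric] intro: ennreal_leI)
      qed
      also have "\<dots> = ennreal (?n powr p) * (\<Sum>j\<in>UNIV. \<integral>\<^sup>+ x. ennreal (l (fst j) x *
              \<bar>real_coord j (g f x) - real_coord j (g h x)\<bar> powr p) \<partial>lebesgue)"
        by (subst nn_integral_cmult; (subst nn_integral_sum)?) auto
      also have "\<dots> \<le> ennreal (?n powr p) * (\<Sum>j\<in>(UNIV :: ('d \<times> bool) set). ennreal \<epsilon>)"
        using C[OF f h fun_cong[OF eq]] by (intro mult_left_mono sum_mono) auto
      also have "\<dots> = ennreal (?n powr p * (?n * \<epsilon>))"
        using \<epsilon> by (subst sum_ennreal) (auto simp: ennreal_mult')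
      also have "?n powr p * (?n * \<epsilon>) = (e / 2) powr p"
        using n unfolding \<epsilon>_def by (simp del: card_prod)
      finally have "Lpw_norm p W (\<lambda>x. f x - h x) \<le> ennreal (e / 2)"
        unfolding Lpw_norm_def using e p by (subst epow_le_iff_powr) auto
      also have "\<dots> < ennreal e" using e by (simp add: ennreal_less_iff)
      finally show ?thesis .
    qed
    show "\<exists>K. finite K \<and> K \<subseteq> F \<and> F \<subseteq> (\<Union>g\<in>K. {f. Lpw_norm p W (\<lambda>x. f x - g x) < ennreal e})"
    proof (intro exI[of _ K] conjI subsetI)
      fix f assume f: "f \<in> F"
      then have "?C f \<in> ?C ` K" using K(3) by blast
      then obtain h where "h \<in> K" "?C f = ?C h" by blast
      then show "f \<in> (\<Union>g\<in>K. {f. Lpw_norm p W (\<lambda>x. f x - g x) < ennreal e})"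
        using close[OF f] K(1) by blast
    qed (use K in auto)
  qed
qed

end
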